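(* Let $n(k)$ denote the minimum number of vertices of an asymmetric $k$-graph with at least two vertices. Then $n(2)=6$, $n(3)=6$, and $n(k)=k+2$ for every integer $k\ge 4$.
   Context: A $k$-graph (a $k$-uniform hypergraph) is a pair $(X,\mathscr{M})$ with $X$ a finite set and $\mathscr{M}\subseteq\binom{X}{k}=\{A\subseteq X: |A|=k\}$. An automorphism is a bijection $\phi:X\to X$ with $\{\phi(M):M\in\mathscr{M}\}=\mathscr{M}$. A $k$-graph is asymmetric if its only automorphism is the identity, and symmetric otherwise. *)

theory Defs
  imports Main
begin

definition kgraph :: "nat \<Rightarrow> 'a set \<Rightarrow> 'a set set \<Rightarrow> bool" where
  "kgraph k X M \<longleftrightarrow> finite X \<and> M \<subseteq> {A. A \<subseteq> X \<and> card A = k}"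

text \<open>Only the values of \<open>\<phi>\<close> on \<open>X\<close> matter, so being the identity is also stated on \<open>X\<close> only.\<close>

definition automorphism :: "'a set \<Rightarrow> 'a set set \<Rightarrow> ('a \<Rightarrow> 'a) \<Rightarrow> bool" where
  "automorphism X M \<phi> \<longleftrightarrow> bij_betw \<phi> X X \<and> {\<phi> ` A |A. A \<in> M} = M"

definition asymmetric :: "'a set \<Rightarrow> 'a set set \<Rightarrow> bool" where
  "asymmetric X M \<longleftrightarrow> (\<forall>\<phi>. automorphism X M \<phi> \<longrightarrow> (\<forall>x\<in>X. \<phi> x = x))"

text \<open>
  The vertices are taken to be natural numbers; this loses nothing, see \<open>asymmetric_orders_iff\<close> below.
  \<open>Inf\<close> of a nonempty set of natural numbers is its minimum, and \<open>Inf {} = 0\<close>, so a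
  positive value of \<open>min_asymmetric_order\<close> is attained.
\<close>

definition asymmetric_orders :: "nat \<Rightarrow> nat set" where
  "asymmetric_orders k =
    {card X |(X :: nat set) M. kgraph k X M \<and> asymmetric X M \<and> card X \<ge> 2}"

definition min_asymmetric_order :: "nat \<Rightarrow> nat" where
  "min_asymmetric_order k = Inf (asymmetric_orders k)"

lemma kgraph_image:
  assumes "kgraph k X M" and f: "inj_on f X"
  shows "kgraph k (f ` X) ((`) f ` M)"
proof -
  have "card (f ` A) = k" if "A \<in> M" for A
  proof -
    have "A \<subseteq> X" "card A = k" using assms(1) that by (auto simp: kgraph_def)
    then show ?thesis using card_image inj_on_subset[OF f] by metis
  qed
  then show ?thesis using assms(1) unfolding kgraph_def by blast
qed

lemma asymmetric_image:
  assumes asym: "asymmetric X M" and M: "\<And>A. A \<in> M \<Longrightarrow> A \<subseteq> X" and f: "inj_on f X"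
  shows "asymmetric (f ` X) ((`) f ` M)"
  unfolding asymmetric_def
proof (intro allI impI)
  fix \<phi> assume a: "automorphism (f ` X) ((`) f ` M) \<phi>"
  define g where "g = inv_into X f"
  have gf: "g (f x) = x" if "x \<in> X" for x using that f by (simp add: g_def)
  have bf: "bij_betw f X (f ` X)" using f by (simp add: bij_betw_def)
  have bg: "bij_betw g (f ` X) X" unfolding g_def by (rule bij_betw_inv_into[OF bf])
  have b\<phi>: "bij_betw \<phi> (f ` X) (f ` X)"
    and m: "(`) \<phi> ` ((`) f ` M) = (`) f ` M"
    using a unfolding automorphism_def Setcompr_eq_image by auto
  have gfA: "g ` f ` A = A" if "A \<in> M" for A
    using M[OF that] gf by (force simp: image_image)
  have "(`) (g \<circ> \<phi> \<circ> f) ` M = (`) g ` ((`) \<phi> ` ((`) f ` M))"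
    by (simp add: image_image image_comp[symmetric])
  also have "\<dots> = (\<lambda>A. g ` f ` A) ` M" unfolding m by (simp add: image_image)
  also have "\<dots> = M" using gfA by simp
  finally have "automorphism X M (g \<circ> \<phi> \<circ> f)"
    unfolding automorphism_def Setcompr_eq_image
    using bij_betw_trans[OF bij_betw_trans[OF bf b\<phi>] bg] by (simp add: comp_assoc)
  then have fixed: "g (\<phi> (f x)) = x" if "x \<in> X" for x
    using asym that unfolding asymmetric_def by fastforce
  show "\<forall>y\<in>f ` X. \<phi> y = y"
  proof
    fix y assume y: "y \<in> f ` X"
    then obtain x where x: "x \<in> X" "y = f x" by blast
    have "\<phi> y \<in> f ` X" using b\<phi> y by (auto simp: bij_betw_def)
    moreover have "g (\<phi> y) = g y" using fixed gf x by simp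
    ultimately show "\<phi> y = y" using bg y by (meson bij_betw_def inj_onD)
  qed
qed

lemma card_in_asymmetric_orders:
  fixes X :: "'a set"
  assumes "kgraph k X M" "asymmetric X M" "card X \<ge> 2"
  shows "card X \<in> asymmetric_orders k"
proof -
  have "finite X" using assms(1) by (simp add: kgraph_def)
  then obtain f :: "'a \<Rightarrow> nat" where f: "inj_on f X"
    using finite_imp_inj_to_nat_seg by blast
  have M: "A \<subseteq> X" if "A \<in> M" for A using assms(1) that by (auto simp: kgraph_def)
  have "asymmetric (f ` X) ((`) f ` M)" by (rule asymmetric_image[OF assms(2) M f])
  then show ?thesis
    unfolding asymmetric_orders_def mem_Collect_eq
    using kgraph_image[OF assms(1) f] assms(3) card_image[OF f] by metis
qed

lemma asymmetric_orders_iff: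
  assumes "infinite (UNIV :: 'a set)"
  shows "n \<in> asymmetric_orders k \<longleftrightarrow>
    (\<exists>(X :: 'a set) M. kgraph k X M \<and> asymmetric X M \<and> card X \<ge> 2 \<and> card X = n)"
proof
  assume "n \<in> asymmetric_orders k"
  then obtain X :: "nat set" and M
    where X: "kgraph k X M" "asymmetric X M" "card X \<ge> 2" "card X = n"
    unfolding asymmetric_orders_def by blast
  obtain f :: "nat \<Rightarrow> 'a" where "inj f"
    using assms infinite_countable_subset by blast
  then have f: "inj_on f X" by (rule inj_on_subset) simp
  have M: "A \<subseteq> X" if "A \<in> M" for A using X(1) that by (auto simp: kgraph_def)
  have "asymmetric (f ` X) ((`) f ` M)" by (rule asymmetric_image[OF X(2) M f])
  then show "\<exists>(X :: 'a set) M. kgraph k X M \<and> asymmetric X M \<and> card X \<ge> 2 \<and> card X = n"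
    using kgraph_image[OF X(1) f] X(3,4) card_image[OF f] by metis
qed (use card_in_asymmetric_orders in blast)

end

theory Submission
  imports Defs "HOL-Combinatorics.Transposition"
begin

text \<open>
  Complementing every edge turns a \<open>k\<close>-graph on \<open>n\<close> vertices into an
  \<open>(n - k)\<close>-graph with the same automorphisms. Hence \<open>k\<close>-graphs on at
  most \<open>k + 1\<close> vertices are essentially 1-graphs, where two vertices can be swapped,
  while \<open>k\<close>-graphs on \<open>k + 2\<close> vertices correspond to graphs, and
  asymmetric graphs exist on \<open>n\<close> vertices for all \<open>n \<ge> 6\<close> but for no
  \<open>n\<close> with \<open>2 \<le> n \<le> 5\<close>: a path together with a vertex joined to
  its second and third vertices is asymmetric if the path has at least 5 vertices, while every
  graph on 4 or 5 vertices is invariant under a transposition or a product of two disjoint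
  transpositions, as a check of the finitely many cases shows. This settles all \<open>k\<close>
  except \<open>k = 3\<close>, where it only gives \<open>n(3) \<ge> 6\<close>; equality is
  witnessed by a 3-graph on 6 vertices whose vertices have pairwise distinct degrees.
\<close>

section \<open>Automorphisms and complementation\<close>

text \<open>Taking images under \<open>\<phi>\<close> is injective on subsets of \<open>X\<close>,
  and an injective self-map of the finite set \<open>M\<close> is onto, so the reverse inclusion
  follows.\<close>

lemma automorphismI:
  assumes "finite X" "M \<subseteq> Pow X" "bij_betw \<phi> X X" "\<And>A. A \<in> M \<Longrightarrow> \<phi> ` A \<in> M"
  shows "automorphism X M \<phi>"
proof -
  have "finite M" using assms(1,2) finite_subset by blast
  moreover have "inj_on ((`) \<phi>) M"
    using assms(2,3) by (meson bij_betw_def inj_on_image_Pow inj_on_subset)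
  ultimately have "(`) \<phi> ` M = M" using assms(4) by (intro endo_inj_surj) auto
  then show ?thesis using assms(3) by (simp add: automorphism_def Setcompr_eq_image)
qed

lemma automorphism_mem:
  assumes "automorphism X M \<phi>" "A \<in> M"
  shows "\<phi> ` A \<in> M"
  using assms by (auto simp: automorphism_def)

lemma asymmetric_automorphism_fixes:
  assumes "asymmetric X M" "automorphism X M \<phi>" "x \<in> X"
  shows "\<phi> x = x"
  using assms by (simp add: asymmetric_def)

lemma kgraph_Pow: "kgraph k X M \<Longrightarrow> M \<subseteq> Pow X"
  by (auto simp: kgraph_def)

lemma kgraph_complement:
  assumes "kgraph k X M"
  shows "kgraph (card X - k) X ((-) X ` M)"
  using assms by (auto simp: kgraph_def card_Diff_subset finite_subset)

lemma complement_complement: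
  assumes "M \<subseteq> Pow X"
  shows "(-) X ` (-) X ` M = M"
proof -
  have "X - (X - A) = A" if "A \<in> M" for A using assms that by blast
  then show ?thesis by (simp add: image_image)
qed

lemma automorphism_complement:
  assumes "finite X" "M \<subseteq> Pow X" "automorphism X M \<phi>"
  shows "automorphism X ((-) X ` M) \<phi>"
proof (rule automorphismI)
  show bij: "bij_betw \<phi> X X" using assms(3) by (simp add: automorphism_def)
  fix B assume "B \<in> (-) X ` M"
  then obtain A where A: "A \<in> M" "B = X - A" by blast
  then have "\<phi> ` B = X - \<phi> ` A"
    using bij assms(2) by (metis PowD bij_betw_def inj_on_image_set_diff order_refl subsetD Diff_subset)
  then show "\<phi> ` B \<in> (-) X ` M" using automorphism_mem[OF assms(3) A(1)] by blast
qed (use assms(1) in auto)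

text \<open>Complementing twice restores \<open>M\<close>, so every automorphism of the complemented
  edge set is one of \<open>M\<close>.\<close>

lemma asymmetric_complement:
  assumes "finite X" "M \<subseteq> Pow X" "asymmetric X M"
  shows "asymmetric X ((-) X ` M)"
  unfolding asymmetric_def
proof (intro allI impI)
  fix \<phi> assume "automorphism X ((-) X ` M) \<phi>"
  then have "automorphism X M \<phi>"
    using automorphism_complement[of X "(-) X ` M" \<phi>] complement_complement[OF assms(2)] assms(1)
    by auto
  then show "\<forall>x\<in>X. \<phi> x = x" using assms(3) by (simp add: asymmetric_def)
qed

section \<open>Transpositions and the bound \<open>k + 2\<close>\<close>

lemma asymmetric_no_transposition:
  assumes "finite X" "M \<subseteq> Pow X" "asymmetric X M" "a \<in> X" "b \<in> X" "a \<noteq> b"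
  shows "\<exists>A\<in>M. transpose a b ` A \<notin> M"
proof (rule ccontr)
  assume "\<not> ?thesis"
  moreover have "bij_betw (transpose a b) X X" using assms(4,5) by simp
  ultimately have "automorphism X M (transpose a b)" using assms(1,2) by (intro automorphismI) auto
  from asymmetric_automorphism_fixes[OF assms(3) this assms(4)] show False using assms(6) by simp
qed

text \<open>With at most \<open>k + 1\<close> vertices every edge is \<open>X\<close> or some
  \<open>X - {c}\<close>, so swapping \<open>a\<close> and \<open>b\<close> is an automorphism once
  \<open>X - {a}\<close> and \<open>X - {b}\<close> are both edges or both non-edges.\<close>

lemma asymmetric_kgraph_card_ge:
  assumes "kgraph k X M" "asymmetric X M" "card X \<ge> 2" "k \<ge> 2"
  shows "card X \<ge> k + 2"
proof (rule ccontr)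
  assume "\<not> ?thesis"
  then have le: "card X \<le> k + 1" by simp
  have fin: "finite X" using assms(1) by (simp add: kgraph_def)
  have "\<exists>a\<in>X. \<exists>b\<in>X. a \<noteq> b \<and> (X - {a} \<in> M \<longleftrightarrow> X - {b} \<in> M)"
  proof (cases "card X \<ge> 3")
    case True
    then obtain Y where "Y \<subseteq> X" "card Y = 3" by (meson obtain_subset_with_card_n)
    then obtain a b c where "{a, b, c} \<subseteq> X" "a \<noteq> b" "a \<noteq> c" "b \<noteq> c"
      by (auto simp: card_3_iff)
    \<comment> \<open>Pigeonhole: three vertices, two truth values.\<close>
    then show ?thesis by (metis insert_subset)
  next
    case False
    then have "card X = 2" using assms(3) by simp
    then obtain a b where X: "X = {a, b}" "a \<noteq> b" by (auto simp: card_2_iff)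
    \<comment> \<open>Here \<open>k \<ge> 2\<close> matters: for \<open>k = 1\<close> the single
      edge \<open>{a}\<close> makes two vertices asymmetric.\<close>
    have "X - {x} \<notin> M" if "x \<in> X" for x
    proof
      assume "X - {x} \<in> M"
      then have "card (X - {x}) = k" using assms(1) by (auto simp: kgraph_def)
      then show False using that fin \<open>card X = 2\<close> assms(4) by simp
    qed
    then show ?thesis using X by blast
  qed
  then obtain a b where ab: "a \<in> X" "b \<in> X" "a \<noteq> b" "X - {a} \<in> M \<longleftrightarrow> X - {b} \<in> M" by blast
  obtain A where A: "A \<in> M" "transpose a b ` A \<notin> M"
    using asymmetric_no_transposition[OF fin kgraph_Pow[OF assms(1)] assms(2) ab(1-3)] by blast
  have "A \<subseteq> X" "card A = k" using A(1) assms(1) by (auto simp: kgraph_def)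
  then have "card (X - A) \<le> 1" using le fin by (simp add: card_Diff_subset finite_subset)
  then consider "X - A = {}" | c where "X - A = {c}"
    by (metis card_0_eq card_1_singletonE fin finite_Diff le_less less_one)
  then show False
  proof cases
    case 1
    then have "A = X" using \<open>A \<subseteq> X\<close> by blast
    then show False using A ab by simp
  next
    case 2
    then have "A = X - {c}" using \<open>A \<subseteq> X\<close> by blast
    then have "transpose a b ` A = X - {transpose a b c}"
      using ab by (simp add: image_set_diff)
    \<comment> \<open>Either \<open>c\<close> is neither \<open>a\<close> nor \<open>b\<close> and
      \<open>A\<close> is fixed, or \<open>A\<close> and its image are \<open>X - {a}\<close> and
      \<open>X - {b}\<close> in some order.\<close>
    then show False using A ab(4) \<open>A = X - {c}\<close> by (auto simp: transpose_def split: if_splits)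
  qed
qed

section \<open>Graphs on four and five vertices\<close>

lemma graph_automorphismI:
  assumes "kgraph 2 X M" "bij_betw \<phi> X X"
    and "\<And>x y. x \<in> X \<Longrightarrow> y \<in> X \<Longrightarrow> x \<noteq> y \<Longrightarrow> {x, y} \<in> M \<Longrightarrow> {\<phi> x, \<phi> y} \<in> M"
  shows "automorphism X M \<phi>"
proof (rule automorphismI)
  fix A assume "A \<in> M"
  moreover from this obtain x y where "A = {x, y}" "x \<noteq> y" "x \<in> X" "y \<in> X"
    using assms(1) by (auto simp: kgraph_def card_2_iff)
  ultimately show "\<phi> ` A \<in> M" using assms(3) by simp
qed (use assms in \<open>auto simp: kgraph_def\<close>)

text \<open>Otherwise the transposition of \<open>a\<close> and \<open>b\<close> is an automorphism;
  the pair \<open>{a, b}\<close> itself is mapped to itself.\<close>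

lemma asymmetric_graph_no_twins:
  assumes "kgraph 2 X M" "asymmetric X M" "a \<in> X" "b \<in> X" "a \<noteq> b"
  shows "\<exists>x\<in>X - {a, b}. ({a, x} \<in> M) \<noteq> ({b, x} \<in> M)"
proof (rule ccontr)
  assume "\<not> ?thesis"
  then have tw: "{a, x} \<in> M \<longleftrightarrow> {b, x} \<in> M" if "x \<in> X" "x \<noteq> a" "x \<noteq> b" for x using that by blast
  have "automorphism X M (transpose a b)"
  proof (rule graph_automorphismI[OF assms(1)])
    show "bij_betw (transpose a b) X X" using assms(3,4) by simp
    define E where "E x y \<longleftrightarrow> {x, y} \<in> M" for x y
    have sym: "E x y \<longleftrightarrow> E y x" for x y by (simp add: E_def insert_commute)
    fix x y assume xy: "x \<in> X" "y \<in> X" "x \<noteq> y" "{x, y} \<in> M"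
    have tw: "E a z \<longleftrightarrow> E b z" if "z \<in> X" "z \<noteq> a" "z \<noteq> b" for z using tw[OF that] by (simp add: E_def)
    have "E x y" using xy by (simp add: E_def)
    then have "E (transpose a b x) (transpose a b y)"
      using tw[of x] tw[of y] xy(1-3) assms(5) sym
      by (metis transpose_apply_first transpose_apply_second transpose_apply_other)
    then show "{transpose a b x, transpose a b y} \<in> M" by (simp add: E_def)
  qed
  from asymmetric_automorphism_fixes[OF assms(2) this assms(3)] show False using assms(5) by simp
qed

text \<open>The map exchanging \<open>a\<close> with \<open>b\<close> and \<open>c\<close> with
  \<open>d\<close> fixes the pairs \<open>{a, b}\<close> and \<open>{c, d}\<close>; the disjuncts
  list the pairs that it exchanges, and one such exchange must break adjacency.\<close>

lemma asymmetric_graph_no_double_transposition: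
  assumes "kgraph 2 X M" "asymmetric X M" "{a, b, c, d} \<subseteq> X" "distinct [a, b, c, d]"
  shows "({a, c} \<in> M) \<noteq> ({b, d} \<in> M) \<or> ({a, d} \<in> M) \<noteq> ({b, c} \<in> M) \<or>
    (\<exists>x\<in>X - {a, b, c, d}. ({a, x} \<in> M) \<noteq> ({b, x} \<in> M) \<or> ({c, x} \<in> M) \<noteq> ({d, x} \<in> M))"
proof (rule ccontr)
  assume n: "\<not> ?thesis"
  then have tw: "({a, x} \<in> M \<longleftrightarrow> {b, x} \<in> M) \<and> ({c, x} \<in> M \<longleftrightarrow> {d, x} \<in> M)"
    if "x \<in> X" "x \<noteq> a" "x \<noteq> b" "x \<noteq> c" "x \<noteq> d" for x using that by blast
  have cr: "{a, c} \<in> M \<longleftrightarrow> {b, d} \<in> M" "{a, d} \<in> M \<longleftrightarrow> {b, c} \<in> M" using n by blast+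
  define \<phi> where "\<phi> = transpose a b \<circ> transpose c d"
  have \<phi>_eq: "\<phi> x = (if x = a then b else if x = b then a else if x = c then d else if x = d then c else x)"
    for x using assms(4) by (auto simp: \<phi>_def transpose_def)
  have "automorphism X M \<phi>"
  proof (rule graph_automorphismI[OF assms(1)])
    show "bij_betw \<phi> X X"
      unfolding \<phi>_def using assms(3) by (intro bij_betw_trans[of _ X X]) simp_all
    define E where "E x y \<longleftrightarrow> {x, y} \<in> M" for x y
    have sym: "E x y \<longleftrightarrow> E y x" for x y by (simp add: E_def insert_commute)
    have ne: "a \<noteq> b" "a \<noteq> c" "a \<noteq> d" "b \<noteq> c" "b \<noteq> d" "c \<noteq> d" using assms(4) by auto
    note comm = sym[of b a] sym[of c a] sym[of d a] sym[of c b] sym[of d b] sym[of d c]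
    fix x y assume "x \<in> X" "y \<in> X" "x \<noteq> y" "{x, y} \<in> M"
    note xy = this[folded E_def] and cr = cr[folded E_def] and tw = tw[folded E_def]
    have "E (\<phi> x) (\<phi> y)"
    proof (cases "x \<in> {a, b, c, d}")
      case True
      then consider "x = a" | "x = b" | "x = c" | "x = d" by blast
      then show ?thesis
        by cases (use xy(2-) tw[of y] cr ne comm in \<open>auto simp: \<phi>_eq\<close>)
    next
      case False
      then have "\<phi> x = x" by (simp add: \<phi>_eq)
      moreover have tw: "E a x \<longleftrightarrow> E b x" "E c x \<longleftrightarrow> E d x" using tw[of x] xy(1) False by auto
      consider "y = a" | "y = b" | "y = c" | "y = d" | "y \<notin> {a, b, c, d}" by blast
      then have "E x (\<phi> y)"
        by cases (use xy(4) tw ne in \<open>simp_all add: \<phi>_eq sym[of x]\<close>)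
      ultimately show ?thesis by simp
    qed
    then show "{\<phi> x, \<phi> y} \<in> M" by (simp add: E_def)
  qed
  from asymmetric_automorphism_fixes[OF assms(2) this, of a] show False
    using assms(3,4) unfolding \<phi>_eq by simp
qed

text \<open>Expands quantifiers over an explicit vertex set into disjunctions, ready for the
  propositional checks below.\<close>

lemma Bex_insert_Diff: "(\<exists>x\<in>insert y S - T. P x) \<longleftrightarrow> y \<notin> T \<and> P y \<or> (\<exists>x\<in>S - T. P x)"
  by auto

lemma asymmetric_graph_card_ne_4:
  assumes "kgraph 2 X M" "asymmetric X M"
  shows "card X \<noteq> 4"
proof
  assume "card X = 4"
  then obtain xs where xs: "set xs = X" "distinct xs" "length xs = 4"
    by (metis card.infinite distinct_card finite_distinct_list zero_neq_numeral)
  then obtain a b c d where "xs = [a, b, c, d]" by (auto simp: numeral_eq_Suc length_Suc_conv)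
  with xs have X: "X = {a, b, c, d}" and
    ne: "a \<noteq> b" "a \<noteq> c" "a \<noteq> d" "b \<noteq> c" "b \<noteq> d" "c \<noteq> d"
    by auto
  note simps = simp_thms insert_iff empty_iff empty_Diff bex_empty distinct.simps list.set insert_subset
    empty_subsetI
  note t = asymmetric_graph_no_twins[OF assms] and
    u = asymmetric_graph_no_double_transposition[OF assms]
  \<comment> \<open>One spelling per unordered pair, so that each potential edge is a single
    propositional atom.\<close>
  have comm: "{b, a} = {a, b}" "{c, a} = {a, c}" "{d, a} = {a, d}" "{c, b} = {b, c}" "{d, b} = {b, d}"
    "{d, c} = {c, d}"
    by auto
  note twins = t[of a b] t[of a c] t[of a d] t[of b c] t[of b d] t[of c d]
  \<comment> \<open>The three splittings of four vertices into two pairs.\<close>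
  note double = u[of a b c d] u[of a c b d] u[of a d b c]
  show False
    using twins[unfolded X Bex_insert_Diff comm, simplified ne ne[symmetric] simps]
      double[unfolded X Bex_insert_Diff comm, simplified ne ne[symmetric] simps]
    by sat
qed

lemma asymmetric_graph_card_ne_5:
  assumes "kgraph 2 X M" "asymmetric X M"
  shows "card X \<noteq> 5"
proof
  assume "card X = 5"
  then obtain xs where xs: "set xs = X" "distinct xs" "length xs = 5"
    by (metis card.infinite distinct_card finite_distinct_list zero_neq_numeral)
  then obtain a b c d e where "xs = [a, b, c, d, e]" by (auto simp: numeral_eq_Suc length_Suc_conv)
  with xs have X: "X = {a, b, c, d, e}" and
    ne: "a \<noteq> b" "a \<noteq> c" "a \<noteq> d" "a \<noteq> e" "b \<noteq> c" "b \<noteq> d" "b \<noteq> e" "c \<noteq> d" "c \<noteq> e" "d \<noteq> e"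
    by auto
  note simps = simp_thms insert_iff empty_iff empty_Diff bex_empty distinct.simps list.set insert_subset
    empty_subsetI
  note t = asymmetric_graph_no_twins[OF assms] and
    u = asymmetric_graph_no_double_transposition[OF assms]
  have comm: "{b, a} = {a, b}" "{c, a} = {a, c}" "{d, a} = {a, d}" "{e, a} = {a, e}" "{c, b} = {b, c}"
    "{d, b} = {b, d}" "{e, b} = {b, e}" "{d, c} = {c, d}" "{e, c} = {c, e}" "{e, d} = {d, e}"
    by auto
  note twins = t[of a b] t[of a c] t[of a d] t[of a e] t[of b c] t[of b d] t[of b e] t[of c d]
    t[of c e] t[of d e]
  \<comment> \<open>Five choices of the fixed vertex, times three splittings of the other
    four.\<close>
  note double = u[of a b c d] u[of a c b d] u[of a d b c] u[of a b c e] u[of a c b e] u[of a e b c]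
    u[of a b d e] u[of a d b e] u[of a e b d] u[of a c d e] u[of a d c e] u[of a e c d]
    u[of b c d e] u[of b d c e] u[of b e c d]
  show False
    using twins[unfolded X Bex_insert_Diff comm, simplified ne ne[symmetric] simps]
      double[unfolded X Bex_insert_Diff comm, simplified ne ne[symmetric] simps]
    by sat
qed

section \<open>An asymmetric graph on \<open>m + 1\<close> vertices\<close>

text \<open>Equivalently, for \<open>m \<ge> 5\<close>, a triangle \<open>1, 2, m\<close> with a
  tail of length 1 at \<open>1\<close> and one of length \<open>m - 3\<close> at \<open>2\<close>.
  The lengths agree for \<open>m = 4\<close>, where the graph is symmetric.\<close>

definition kite_adj :: "nat \<Rightarrow> nat \<Rightarrow> nat \<Rightarrow> bool" where
  "kite_adj m x y \<longleftrightarrow> x < m \<and> y < m \<and> (y = Suc x \<or> x = Suc y)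
    \<or> x = m \<and> y \<in> {1, 2} \<or> y = m \<and> x \<in> {1, 2}"

definition kite :: "nat \<Rightarrow> nat set set" where
  "kite m = {{x, y} |x y. kite_adj m x y}"

lemma kite_adj_sym: "kite_adj m x y \<Longrightarrow> kite_adj m y x"
  by (auto simp: kite_adj_def)

lemma mem_kite_iff: "{x, y} \<in> kite m \<longleftrightarrow> kite_adj m x y"
  by (auto simp: kite_def doubleton_eq_iff dest: kite_adj_sym)

lemma kgraph_kite:
  assumes "m \<ge> 3"
  shows "kgraph 2 {..m} (kite m)"
  using assms by (auto simp: kgraph_def kite_def kite_adj_def card_insert_if)

lemma kite_triangle:
  assumes "m \<ge> 4" "kite_adj m x y" "kite_adj m y z" "kite_adj m x z"
  shows "x \<in> {1, 2, m}"
  using assms by (auto simp: kite_adj_def)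

text \<open>The variables stand for the images of \<open>0, 1, 2, 3, 4, m\<close> under an
  automorphism. The triangle must go to the only triangle, and its vertices are told apart by their
  tails.\<close>

lemma kite_embedding_start:
  assumes m: "m \<ge> 5" and dist: "distinct [a, b, c, d, z]" "e \<noteq> c"
    and adj: "kite_adj m a b" "kite_adj m b c" "kite_adj m c d" "kite_adj m d e"
      "kite_adj m b z" "kite_adj m c z"
  shows "a = 0 \<and> b = 1 \<and> c = 2 \<and> z = m"
proof -
  note sym = adj[THEN kite_adj_sym]
  have tri: "b \<in> {1, 2, m}" "c \<in> {1, 2, m}" "z \<in> {1, 2, m}"
    using kite_triangle[of m b c z] kite_triangle[of m c z b] kite_triangle[of m z b c] adj sym m
    by simp_all
  then have out: "a \<notin> {1, 2, m}" "d \<notin> {1, 2, m}" using dist by auto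
  \<comment> \<open>The vertex \<open>m\<close> has no neighbour outside the triangle, but
    \<open>b\<close> and \<open>c\<close> do.\<close>
  then have "b \<noteq> m" "c \<noteq> m" using adj by (auto simp: kite_adj_def)
  then have z: "z = m" using tri dist by auto
  \<comment> \<open>The tail at \<open>1\<close> ends at \<open>0\<close>, whereas the walk
    \<open>c, d, e\<close> continues without returning to \<open>c\<close>.\<close>
  have "c \<noteq> 1"
  proof
    assume "c = 1"
    then have "d = 0" using adj(3) out by (auto simp: kite_adj_def)
    then have "e = 1" using adj(4) m by (auto simp: kite_adj_def)
    then show False using \<open>c = 1\<close> dist by simp
  qed
  then have "c = 2" and b: "b = 1" using tri dist \<open>b \<noteq> m\<close> \<open>c \<noteq> m\<close> by auto
  moreover have "a = 0" using adj(1) b out by (auto simp: kite_adj_def)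
  ultimately show ?thesis using z by simp
qed

lemma asymmetric_kite:
  assumes m: "m \<ge> 5"
  shows "asymmetric {..m} (kite m)"
  unfolding asymmetric_def
proof (intro allI impI)
  fix \<phi> assume aut: "automorphism {..m} (kite m) \<phi>"
  have adj: "kite_adj m (\<phi> x) (\<phi> y)" if "kite_adj m x y" for x y
    using automorphism_mem[OF aut, of "{x, y}"] that by (simp add: mem_kite_iff)
  have bij: "bij_betw \<phi> {..m} {..m}" using aut by (simp add: automorphism_def)
  have inj: "\<phi> x = \<phi> y \<longleftrightarrow> x = y" if "x \<le> m" "y \<le> m" for x y
    using bij that by (auto simp: bij_betw_def inj_on_eq_iff)
  have start: "\<phi> 0 = 0 \<and> \<phi> 1 = 1 \<and> \<phi> 2 = 2 \<and> \<phi> m = m"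
  proof (rule kite_embedding_start[OF m])
    show "distinct [\<phi> 0, \<phi> 1, \<phi> 2, \<phi> 3, \<phi> m]" "\<phi> 4 \<noteq> \<phi> 2" using inj m by simp_all
  qed (rule adj, use m in \<open>simp add: kite_adj_def\<close>)+
  have "\<phi> i = i" if "i < m" for i
    using that
  proof (induction i rule: less_induct)
    case (less i)
    show ?case
    proof (cases "i < 3")
      case True
      then consider "i = 0" | "i = 1" | "i = 2" by linarith
      then show ?thesis using start by cases auto
    next
      case False
      then obtain j where j: "i = Suc (Suc j)" "j \<ge> 1" by (cases i; cases "i - 1") auto
      have p: "\<phi> j = j" "\<phi> (Suc j) = Suc j" using less j by auto
      have "kite_adj m (Suc j) (\<phi> i)"
        using adj[of "Suc j" i] p less.prems j by (auto simp: kite_adj_def)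
      \<comment> \<open>The neighbours of \<open>Suc j\<close> are \<open>j\<close>,
        \<open>i\<close> (as \<open>i < m\<close>) and possibly \<open>m\<close>; \<open>j\<close>
        and \<open>m\<close> are already taken as images.\<close>
      moreover have "\<phi> i \<noteq> j" "\<phi> i \<noteq> m" using inj[of i j] inj[of i m] p start less.prems j by auto
      ultimately show ?thesis using less.prems j by (auto simp: kite_adj_def)
    qed
  qed
  then show "\<forall>x\<in>{..m}. \<phi> x = x" using start by (auto simp: le_less)
qed

section \<open>A 3-graph on six vertices with distinct degrees\<close>

text \<open>An automorphism maps the edges through \<open>x\<close> bijectively onto those through
  \<open>\<phi> x\<close>, so it preserves degrees.\<close>

lemma asymmetric_if_distinct_degrees:
  assumes "M \<subseteq> Pow X" "inj_on (\<lambda>x. card {A \<in> M. x \<in> A}) X"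
  shows "asymmetric X M"
  unfolding asymmetric_def
proof (intro allI impI ballI)
  fix \<phi> x assume aut: "automorphism X M \<phi>" and x: "x \<in> X"
  have bij: "bij_betw \<phi> X X" using aut by (simp add: automorphism_def)
  then have inj: "inj_on \<phi> X" and \<phi>x: "\<phi> x \<in> X" using x by (auto simp: bij_betw_def)
  have mem: "\<phi> x \<in> \<phi> ` A \<longleftrightarrow> x \<in> A" if "A \<in> M" for A
    using inj x that assms(1) by (meson PowD inj_on_image_mem_iff subsetD)
  have "(`) \<phi> ` M = M" using aut by (simp add: automorphism_def Setcompr_eq_image)
  then have "{A \<in> M. \<phi> x \<in> A} = {A \<in> (`) \<phi> ` M. \<phi> x \<in> A}" by simp
  also have "\<dots> = (`) \<phi> ` {A \<in> M. x \<in> A}" using mem by auto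
  finally have "{A \<in> M. \<phi> x \<in> A} = (`) \<phi> ` {A \<in> M. x \<in> A}" .
  moreover have "inj_on ((`) \<phi>) {A \<in> M. x \<in> A}"
    using inj_on_image_Pow[OF inj] assms(1) by (rule_tac inj_on_subset) auto
  ultimately have "card {A \<in> M. \<phi> x \<in> A} = card {A \<in> M. x \<in> A}" by (simp add: card_image)
  then show "\<phi> x = x" using assms(2) x \<phi>x by (auto dest: inj_onD)
qed

text \<open>These are the triples from \<open>{0,...,5}\<close> with sum at most 6.\<close>

definition witness3 :: "nat set set" where
  "witness3 = {{0,1,2}, {0,1,3}, {0,1,4}, {0,1,5}, {0,2,3}, {0,2,4}, {1,2,3}}"

lemma kgraph_witness3: "kgraph 3 {..<6} witness3"
  by (auto simp: kgraph_def witness3_def)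

lemma asymmetric_witness3: "asymmetric {..<6} witness3"
proof (rule asymmetric_if_distinct_degrees)
  show "witness3 \<subseteq> Pow {..<6}" by (auto simp: witness3_def)
  have deg: "card {A \<in> witness3. x \<in> A} = 6 - x" if "x < 6" for x
  proof -
    have filter_insert: "{A \<in> insert B S. P A} =
        (if P B then insert B {A \<in> S. P A} else {A \<in> S. P A})"
      for B :: "nat set" and S P by auto
    have filter_empty: "{A \<in> {}. P A} = {}" for P :: "nat set \<Rightarrow> bool" by simp
    from that consider "x = 0" | "x = 1" | "x = 2" | "x = 3" | "x = 4" | "x = 5" by linarith
    then show ?thesis
    proof cases
      case 1
      show ?thesis unfolding \<open>x = 0\<close> witness3_def filter_insert filter_empty
        by (simp add: card_insert_if set_eq_subset)
    next
      case 2
      show ?thesis unfolding \<open>x = 1\<close> witness3_def filter_insert filter_empty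
        by (simp add: card_insert_if set_eq_subset)
    next
      case 3
      show ?thesis unfolding \<open>x = 2\<close> witness3_def filter_insert filter_empty
        by (simp add: card_insert_if set_eq_subset)
    next
      case 4
      show ?thesis unfolding \<open>x = 3\<close> witness3_def filter_insert filter_empty
        by (simp add: card_insert_if set_eq_subset)
    next
      case 5
      show ?thesis unfolding \<open>x = 4\<close> witness3_def filter_insert filter_empty
        by (simp add: card_insert_if set_eq_subset)
    next
      case 6
      show ?thesis unfolding \<open>x = 5\<close> witness3_def filter_insert filter_empty
        by (simp add: card_insert_if set_eq_subset)
    qed
  qed
  show "inj_on (\<lambda>x. card {A \<in> witness3. x \<in> A}) {..<6}"
    by (rule inj_onI) (use deg in auto)
qed

section \<open>The values of the minimum\<close>

lemma min_asymmetric_order_eqI: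
  assumes "kgraph k X M" "asymmetric X M" "card X = n" "n \<ge> 2"
    and "\<And>(Y :: nat set) N. kgraph k Y N \<Longrightarrow> asymmetric Y N \<Longrightarrow> card Y \<ge> 2 \<Longrightarrow> n \<le> card Y"
  shows "min_asymmetric_order k = n"
  unfolding min_asymmetric_order_def
proof (rule cInf_eq_minimum)
  show "n \<in> asymmetric_orders k" using card_in_asymmetric_orders assms(1-4) by metis
qed (use assms(5) in \<open>auto simp: asymmetric_orders_def\<close>)

theorem theorem2:
  shows "min_asymmetric_order 2 = 6
       \<and> min_asymmetric_order 3 = 6
       \<and> (\<forall>k\<ge>4. min_asymmetric_order k = k + 2)"
proof (intro conjI allI impI)
  show "min_asymmetric_order 2 = 6"
  proof (rule min_asymmetric_order_eqI)
    show "kgraph 2 {..5} (kite 5)" "asymmetric {..5} (kite 5)"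
      by (simp_all add: kgraph_kite asymmetric_kite)
    fix Y :: "nat set" and N assume Y: "kgraph 2 Y N" "asymmetric Y N" "card Y \<ge> 2"
    then show "6 \<le> card Y"
      using asymmetric_kgraph_card_ge[OF Y] asymmetric_graph_card_ne_4[OF Y(1,2)]
        asymmetric_graph_card_ne_5[OF Y(1,2)] by simp
  qed auto
  show "min_asymmetric_order 3 = 6"
  proof (rule min_asymmetric_order_eqI[OF kgraph_witness3 asymmetric_witness3])
    fix Y :: "nat set" and N assume Y: "kgraph 3 Y N" "asymmetric Y N" "card Y \<ge> 2"
    have "asymmetric Y ((-) Y ` N)"
      using Y kgraph_Pow by (intro asymmetric_complement) (auto simp: kgraph_def)
    \<comment> \<open>On five vertices the complemented edges have \<open>5 - 3 = 2\<close>
      elements.\<close>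
    then have "card Y \<noteq> 5"
      using kgraph_complement[OF Y(1)] asymmetric_graph_card_ne_5 by fastforce
    then show "6 \<le> card Y" using asymmetric_kgraph_card_ge[OF Y] by simp
  qed auto
  fix k :: nat assume k: "k \<ge> 4"
  let ?X = "{..k + 1}"
  show "min_asymmetric_order k = k + 2"
  proof (rule min_asymmetric_order_eqI)
    \<comment> \<open>The kite has \<open>k + 2\<close> vertices, so complements of its edges have
      size \<open>k\<close>; \<open>k \<ge> 4\<close> gives the \<open>k + 1 \<ge> 5\<close> needed
      for asymmetry.\<close>
    show "kgraph k ?X ((-) ?X ` kite (k + 1))"
      using kgraph_complement[OF kgraph_kite[of "k + 1"]] k by simp
    show "asymmetric ?X ((-) ?X ` kite (k + 1))"
      using k by (intro asymmetric_complement asymmetric_kite kgraph_Pow[OF kgraph_kite]) auto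
    show "k + 2 \<le> card Y" if "kgraph k Y N" "asymmetric Y N" "card Y \<ge> 2" for Y :: "nat set" and N
      using asymmetric_kgraph_card_ge[OF that] k by simp
  qed auto
qed

end
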